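(* Let $G=(V,E)$ be a flow graph with vertex set $V=\{1,\dots,n\}$, edges indexed $n+1,\dots,t$, positive symmetric gains $B_{i,j}$ on the edges, and gain matrix $\mathbf H$. Let $\mathcal F\subseteq E$. Then $\mathcal F$ is stealthily attackable if and only if every cycle $C$ of $G$ satisfies either $C\cap\mathcal F=\emptyset$ or $\#(C\cap\mathcal F)\ge2$. Moreover, if $\mathcal F$ is stealthily attackable, then the edge variation factor satisfies \[ 1\le\theta(\mathcal F)\le k(\mathcal F)-1, \] where $k(\mathcal F)$ is the number of connected components of the graph $G\setminus\mathcal F$ obtained from $G$ by removing the edges in $\mathcal F$ (keeping all vertices).
   Context: Flow graph: Let $G=(V,E)$ be a graph with $V=\{1,\dots,n\}$ and edges indexed by $\{n+1,\dots,t\}$. Each edge joining $i$ and $j$ has a gain $B_{i,j}=B_{j,i}>0$. For an edge with index $f$ joining $i$ and $j$, let $\mathbf h_f$ be the $1\times n$ row vector with entry $B_{i,j}$ in position $i$, entry $-B_{i,j}$ in position $j$, and zeros elsewhere; thus $\mathbf h_f\cdot\mathbf x=B_{i,j}(x_i-x_j)$. For a vertex $i$, let $\mathbf h_i$ be the $1\times n$ row vector with entry $\sum_{u\sim i}B_{i,u}$ in position $i$, entry $-B_{i,j}$ in position $j$ for each neighbour $j\sim i$, and zeros elsewhere. The gain matrix $\mathbf H$ is the $t\times n$ matrix with rows $\mathbf h_1,\dots,\mathbf h_t$. Attack vectors: An $\mathcal F$-attack vector is a vector $\mathbf a=(a_1,\dots,a_t)^T$ such that $a_l\ne0$ if and only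 if either $l$ is the index of an edge in $\mathcal F$ or $l$ is a vertex incident to an edge in $\mathcal F$. The set $\mathcal F$ is stealthily attackable if there exists an $\mathcal F$-attack vector of the form $\mathbf a=\mathbf H\mathbf s$ for some $\mathbf s\in\mathbb R^n$; such an $\mathbf s$ is called an $\mathcal F$-stealth vector. For any $\mathcal F$-stealth vector, $s_i\ne s_j$ for edges $(i,j)\in\mathcal F$. Edge variation factor: \[ \theta(\mathcal F)=\inf_{\mathbf s}\frac{\max_{(i,j)\in\mathcal F}|s_i-s_j|}{\min_{(i,j)\in\mathcal F}|s_i-s_j|}, \] where the infimum is over all $\mathcal F$-stealth vectors $\mathbf s$. *)

theory Defs
  imports Complex_Main "Jordan_Normal_Form.Matrix"
begin

text \<open>
  Vertices are the numbers \<open>1, \<dots>, n\<close> and edges the numbers \<open>n + 1, \<dots>, t\<close>.  The order of the two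
  ends of an edge is arbitrary and only fixes the sign of its row in the gain matrix.
\<close>

record flow_graph =
  num_verts :: nat
  num_rows :: nat
  end1 :: "nat \<Rightarrow> nat"
  end2 :: "nat \<Rightarrow> nat"
  gain :: "nat \<Rightarrow> nat \<Rightarrow> real"

definition vertices :: "flow_graph \<Rightarrow> nat set" where
  "vertices G = {1..num_verts G}"

definition edges :: "flow_graph \<Rightarrow> nat set" where
  "edges G = {num_verts G + 1..num_rows G}"

definition ends :: "flow_graph \<Rightarrow> nat \<Rightarrow> nat set" where
  "ends G f = {end1 G f, end2 G f}"

definition joined :: "flow_graph \<Rightarrow> nat set \<Rightarrow> nat \<Rightarrow> nat \<Rightarrow> bool" where
  "joined G S i j \<longleftrightarrow> (\<exists>f\<in>S. ends G f = {i, j})"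

definition adjacent :: "flow_graph \<Rightarrow> nat \<Rightarrow> nat \<Rightarrow> bool" where
  "adjacent G i j \<longleftrightarrow> joined G (edges G) i j"

text \<open>Gains belong to pairs of vertices, so the graph is simple: no loops, no parallel edges.\<close>

definition is_flow_graph :: "flow_graph \<Rightarrow> bool" where
  "is_flow_graph G \<longleftrightarrow>
     num_verts G \<le> num_rows G \<and>
     (\<forall>f\<in>edges G. ends G f \<subseteq> vertices G \<and> end1 G f \<noteq> end2 G f) \<and>
     inj_on (ends G) (edges G) \<and>
     (\<forall>i j. adjacent G i j \<longrightarrow> gain G i j = gain G j i \<and> gain G i j > 0)"

definition gain_row :: "flow_graph \<Rightarrow> nat \<Rightarrow> nat \<Rightarrow> real" where
  "gain_row G l k =
     (if l \<in> vertices G then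
        (if k = l then (\<Sum>u | u \<in> vertices G \<and> adjacent G l u. gain G l u)
         else if adjacent G l k then - gain G l k
         else 0)
      else
        (if k = end1 G l then gain G (end1 G l) (end2 G l)
         else if k = end2 G l then - gain G (end1 G l) (end2 G l)
         else 0))"

text \<open>
  Library vectors and matrices are indexed from 0, whereas vertices and edges are numbered from 1:
  the component belonging to the number \<open>l\<close> is \<open>entry v l\<close>.
\<close>

definition entry :: "real vec \<Rightarrow> nat \<Rightarrow> real" where
  "entry v l = v $ (l - 1)"

definition gain_matrix :: "flow_graph \<Rightarrow> real mat" where
  "gain_matrix G = mat (num_rows G) (num_verts G) (\<lambda>(r, c). gain_row G (r + 1) (c + 1))"

definition attack_vector :: "flow_graph \<Rightarrow> nat set \<Rightarrow> real vec \<Rightarrow> bool" where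
  "attack_vector G F a \<longleftrightarrow>
     a \<in> carrier_vec (num_rows G) \<and>
     (\<forall>l\<in>{1..num_rows G}.
        entry a l \<noteq> 0 \<longleftrightarrow> l \<in> F \<or> (l \<in> vertices G \<and> (\<exists>f\<in>F. l \<in> ends G f)))"

definition stealth_vector :: "flow_graph \<Rightarrow> nat set \<Rightarrow> real vec \<Rightarrow> bool" where
  "stealth_vector G F s \<longleftrightarrow>
     s \<in> carrier_vec (num_verts G) \<and> attack_vector G F (gain_matrix G *\<^sub>v s)"

definition stealthily_attackable :: "flow_graph \<Rightarrow> nat set \<Rightarrow> bool" where
  "stealthily_attackable G F \<longleftrightarrow>
     (\<exists>a. attack_vector G F a \<and> (\<exists>s\<in>carrier_vec (num_verts G). a = gain_matrix G *\<^sub>v s))"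

definition edge_difference :: "flow_graph \<Rightarrow> real vec \<Rightarrow> nat \<Rightarrow> real" where
  "edge_difference G s f = \<bar>entry s (end1 G f) - entry s (end2 G f)\<bar>"

text \<open>
  Meaningful only for nonempty, stealthily attackable \<open>F\<close>; otherwise \<open>Max\<close>, \<open>Min\<close> or \<open>Inf\<close> is
  applied to the empty set.
\<close>

definition edge_variation_factor :: "flow_graph \<Rightarrow> nat set \<Rightarrow> real" where
  "edge_variation_factor G F =
     Inf {Max (edge_difference G s ` F) / Min (edge_difference G s ` F) | s. stealth_vector G F s}"

text \<open>A cycle is given by its set of edges.\<close>

definition is_cycle :: "flow_graph \<Rightarrow> nat set \<Rightarrow> bool" where
  "is_cycle G C \<longleftrightarrow>
     (\<exists>vs. distinct vs \<and> length vs \<ge> 3 \<and> set vs \<subseteq> vertices G \<and>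
        (\<forall>i<length vs. adjacent G (vs ! i) (vs ! (Suc i mod length vs))) \<and>
        C = {f \<in> edges G. \<exists>i<length vs. ends G f = {vs ! i, vs ! (Suc i mod length vs)}})"

definition connected_after_removal :: "flow_graph \<Rightarrow> nat set \<Rightarrow> (nat \<times> nat) set" where
  "connected_after_removal G F =
     {(u, v). u \<in> vertices G \<and> v \<in> vertices G \<and> (u, v) \<in> {(i, j). joined G (edges G - F) i j}\<^sup>*}"

definition num_components_after_removal :: "flow_graph \<Rightarrow> nat set \<Rightarrow> nat" where
  "num_components_after_removal G F = card (vertices G // connected_after_removal G F)"

end

theory Submission
  imports Defs
begin

text \<open>
  A vector \<open>s\<close> is an \<open>F\<close>-stealth vector iff it is constant on the components of \<open>G - F\<close>, separates
  the ends of every edge in \<open>F\<close>, and has nonzero divergence at every end of an edge in \<open>F\<close>.  Around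
  a cycle the differences of \<open>s\<close> sum to zero, so a cycle cannot meet \<open>F\<close> exactly once.  Conversely,
  if no cycle does, every edge in \<open>F\<close> joins two different components; numbering the \<open>k\<close> components
  \<open>0, \<dots>, k - 1\<close> yields differences between \<open>1\<close> and \<open>k - 1\<close> on \<open>F\<close>, and an arbitrarily small
  perturbation of this numbering avoids the finitely many hyperplanes of vanishing divergence.
\<close>

text \<open>Taken of a function on vertices rather than of a library vector, so that it can be read
  as a linear functional of values prescribed per component.\<close>

definition divergence :: "flow_graph \<Rightarrow> (nat \<Rightarrow> real) \<Rightarrow> nat \<Rightarrow> real" where
  "divergence G x v = (\<Sum>u | u \<in> vertices G \<and> adjacent G v u. gain G v u * (x v - x u))"

section \<open>Elementary facts on flow graphs\<close>

lemma finite_vertices [simp]: "finite (vertices G)"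
  by (simp add: vertices_def)

lemma finite_edges [simp]: "finite (edges G)"
  by (simp add: edges_def)

lemma joined_sym: "joined G S i j \<Longrightarrow> joined G S j i"
  by (simp add: joined_def insert_commute)

lemma joined_mono: "joined G S i j \<Longrightarrow> S \<subseteq> T \<Longrightarrow> joined G T i j"
  by (auto simp: joined_def)

lemma joined_ends: "f \<in> S \<Longrightarrow> joined G S (end1 G f) (end2 G f)"
  by (auto simp: joined_def ends_def)

lemma adjacent_irrefl:
  assumes "is_flow_graph G"
  shows "\<not> adjacent G v v"
proof
  assume "adjacent G v v"
  then obtain f where "f \<in> edges G" "{end1 G f, end2 G f} = {v, v}"
    by (auto simp: adjacent_def joined_def ends_def)
  with assms show False by (auto simp: is_flow_graph_def doubleton_eq_iff)
qed

lemma adjacent_vertices: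
  assumes "is_flow_graph G" "adjacent G i j"
  shows "i \<in> vertices G" "j \<in> vertices G"
  using assms unfolding is_flow_graph_def adjacent_def joined_def by blast+

lemma end_in_vertices:
  assumes "is_flow_graph G" "f \<in> edges G"
  shows "end1 G f \<in> vertices G" "end2 G f \<in> vertices G"
  using assms by (auto simp: is_flow_graph_def ends_def)

lemma adjacent_ends: "f \<in> edges G \<Longrightarrow> adjacent G (end1 G f) (end2 G f)"
  by (auto simp: adjacent_def joined_ends)

section \<open>The gain matrix applied to a vector, and stealth vectors\<close>

lemma entry_gain_matrix_mult:
  assumes "s \<in> carrier_vec (num_verts G)" "l \<in> {1..num_rows G}"
  shows "entry (gain_matrix G *\<^sub>v s) l = (\<Sum>k\<in>vertices G. gain_row G l k * entry s k)"
proof -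
  have "entry (gain_matrix G *\<^sub>v s) l = (\<Sum>c<num_verts G. gain_row G l (Suc c) * s $ c)"
    using assms
    by (auto simp: entry_def gain_matrix_def scalar_prod_def lessThan_atLeast0 intro!: sum.cong)
  also have "\<dots> = (\<Sum>k\<in>vertices G. gain_row G l k * entry s k)"
    by (simp add: vertices_def entry_def sum.atLeast1_atMost_eq)
  finally show ?thesis .
qed

lemma entry_gain_matrix_edge:
  assumes G: "is_flow_graph G" and s: "s \<in> carrier_vec (num_verts G)" and f: "f \<in> edges G"
  shows "entry (gain_matrix G *\<^sub>v s) f =
    gain G (end1 G f) (end2 G f) * (entry s (end1 G f) - entry s (end2 G f))"
proof -
  let ?i = "end1 G f" and ?j = "end2 G f"
  have row: "f \<in> {1..num_rows G}" "f \<notin> vertices G"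
    using f by (auto simp: edges_def vertices_def)
  have ne: "?i \<noteq> ?j" using G f by (auto simp: is_flow_graph_def)
  have "entry (gain_matrix G *\<^sub>v s) f = (\<Sum>k\<in>vertices G. gain_row G f k * entry s k)"
    by (rule entry_gain_matrix_mult[OF s row(1)])
  also have "\<dots> = (\<Sum>k\<in>{?i, ?j}. gain_row G f k * entry s k)"
    using end_in_vertices[OF G f] row(2)
    by (intro sum.mono_neutral_right) (auto simp: gain_row_def)
  also have "\<dots> = gain G ?i ?j * (entry s ?i - entry s ?j)"
    using ne row(2) by (simp add: gain_row_def algebra_simps)
  finally show ?thesis .
qed

lemma entry_gain_matrix_vertex:
  assumes G: "is_flow_graph G" and s: "s \<in> carrier_vec (num_verts G)" and v: "v \<in> vertices G"
  shows "entry (gain_matrix G *\<^sub>v s) v = divergence G (entry s) v"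
proof -
  let ?N = "{u. u \<in> vertices G \<and> adjacent G v u}"
  have row: "v \<in> {1..num_rows G}"
    using v G by (auto simp: vertices_def is_flow_graph_def)
  have irr: "\<not> adjacent G v v" by (rule adjacent_irrefl[OF G])
  have "entry (gain_matrix G *\<^sub>v s) v = (\<Sum>k\<in>vertices G. gain_row G v k * entry s k)"
    by (rule entry_gain_matrix_mult[OF s row])
  \<comment> \<open>The row of \<open>v\<close> is supported on \<open>v\<close> and its neighbours;
    there are no loops, so the diagonal term splits off.\<close>
  also have "\<dots> = (\<Sum>k\<in>insert v ?N. gain_row G v k * entry s k)"
    using v by (intro sum.mono_neutral_right) (auto simp: gain_row_def)
  also have "\<dots> = (\<Sum>u\<in>?N. gain G v u) * entry s v + (\<Sum>k\<in>?N. gain_row G v k * entry s k)"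
    using v irr by (subst sum.insert) (auto simp: gain_row_def)
  also have "(\<Sum>k\<in>?N. gain_row G v k * entry s k) = (\<Sum>u\<in>?N. - (gain G v u * entry s u))"
    using v irr by (intro sum.cong) (auto simp: gain_row_def)
  finally show ?thesis
    by (simp add: divergence_def algebra_simps sum_distrib_left sum_negf sum_subtractf)
qed

text \<open>Vertex and edge indices are disjoint, so the support condition splits in two. Gains are
  positive, so an edge entry vanishes exactly when \<open>s\<close> agrees at the two ends; a vertex
  entry is the divergence of \<open>s\<close>.\<close>

lemma stealth_vector_iff:
  assumes G: "is_flow_graph G" and F: "F \<subseteq> edges G" and s: "s \<in> carrier_vec (num_verts G)"
  shows "stealth_vector G F s \<longleftrightarrow>
    (\<forall>f\<in>edges G. entry s (end1 G f) \<noteq> entry s (end2 G f) \<longleftrightarrow> f \<in> F) \<and>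
    (\<forall>v\<in>vertices G. divergence G (entry s) v \<noteq> 0 \<longleftrightarrow> (\<exists>f\<in>F. v \<in> ends G f))"
proof -
  have rows: "{1..num_rows G} = edges G \<union> vertices G" "edges G \<inter> vertices G = {}"
    using G by (auto simp: edges_def vertices_def is_flow_graph_def)
  have carrier: "gain_matrix G *\<^sub>v s \<in> carrier_vec (num_rows G)"
    by (rule mult_mat_vec_carrier[OF _ s]) (simp add: gain_matrix_def)
  have edge: "entry (gain_matrix G *\<^sub>v s) f \<noteq> 0 \<longleftrightarrow> entry s (end1 G f) \<noteq> entry s (end2 G f)"
    if "f \<in> edges G" for f
  proof -
    have "gain G (end1 G f) (end2 G f) > 0"
      using G adjacent_ends[OF that] by (simp add: is_flow_graph_def)
    then show ?thesis by (simp add: entry_gain_matrix_edge[OF G s that])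
  qed
  have "stealth_vector G F s \<longleftrightarrow>
    (\<forall>l\<in>edges G \<union> vertices G. entry (gain_matrix G *\<^sub>v s) l \<noteq> 0 \<longleftrightarrow>
      l \<in> F \<or> (l \<in> vertices G \<and> (\<exists>f\<in>F. l \<in> ends G f)))"
    unfolding stealth_vector_def attack_vector_def rows(1) using carrier s by simp
  also have "\<dots> \<longleftrightarrow>
    (\<forall>f\<in>edges G. entry (gain_matrix G *\<^sub>v s) f \<noteq> 0 \<longleftrightarrow> f \<in> F) \<and>
    (\<forall>v\<in>vertices G. entry (gain_matrix G *\<^sub>v s) v \<noteq> 0 \<longleftrightarrow> (\<exists>f\<in>F. v \<in> ends G f))"
    using F rows(2) by blast
  finally show ?thesis
    using edge by (simp add: entry_gain_matrix_vertex[OF G s])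
qed

lemma stealthily_attackable_iff: "stealthily_attackable G F \<longleftrightarrow> (\<exists>s. stealth_vector G F s)"
  by (auto simp: stealthily_attackable_def stealth_vector_def)

section \<open>Stealth vectors force the cycle condition\<close>

lemma bij_betw_Suc_mod:
  assumes "0 < (n::nat)"
  shows "bij_betw (\<lambda>i. Suc i mod n) {..<n} {..<n}"
proof (rule bij_betw_imageI)
  show inj: "inj_on (\<lambda>i. Suc i mod n) {..<n}"
    by (auto simp: inj_on_def mod_Suc split: if_splits)
  show "(\<lambda>i. Suc i mod n) ` {..<n} = {..<n}"
    using assms by (intro endo_inj_surj[OF _ _ inj]) auto
qed

text \<open>If \<open>f\<close> were the only edge of \<open>F\<close> on the cycle, all other
  differences along it would vanish. The differences telescope to 0, so the one across
  \<open>f\<close> would vanish too, although \<open>s\<close> separates the ends of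
  \<open>f\<close>.\<close>

lemma stealth_vector_cycle:
  assumes G: "is_flow_graph G" and F: "F \<subseteq> edges G" and s: "stealth_vector G F s"
    and C: "is_cycle G C" and ne: "C \<inter> F \<noteq> {}"
  shows "card (C \<inter> F) \<ge> 2"
proof (rule ccontr)
  assume "\<not> card (C \<inter> F) \<ge> 2"
  moreover have fin: "finite (C \<inter> F)"
    using F by (meson finite_edges finite_Int finite_subset)
  moreover have "card (C \<inter> F) \<noteq> 0" using fin ne by simp
  ultimately have "card (C \<inter> F) = 1" by linarith
  then obtain f where f: "C \<inter> F = {f}" by (auto simp: card_1_singleton_iff)
  have "s \<in> carrier_vec (num_verts G)" using s by (simp add: stealth_vector_def)
  note sep = stealth_vector_iff[OF G F this, THEN iffD1, OF s, THEN conjunct1, rule_format]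
  obtain vs where vs: "distinct vs" "length vs \<ge> 3"
      "\<And>i. i < length vs \<Longrightarrow> adjacent G (vs ! i) (vs ! (Suc i mod length vs))"
    and C_eq: "C = {f \<in> edges G. \<exists>i<length vs. ends G f = {vs ! i, vs ! (Suc i mod length vs)}}"
    using C unfolding is_cycle_def by blast
  let ?n = "length vs"
  let ?next = "\<lambda>i. Suc i mod ?n"
  let ?x = "entry s"
  have "f \<in> C" using f by auto
  then obtain m where m: "m < ?n" "ends G f = {vs ! m, vs ! ?next m}"
    unfolding C_eq by auto
  have flat: "?x (vs ! i) - ?x (vs ! ?next i) = 0" if i: "i < ?n" "i \<noteq> m" for i
  proof -
    obtain g where g: "g \<in> edges G" "ends G g = {vs ! i, vs ! ?next i}"
      using vs(3)[OF i(1)] by (auto simp: adjacent_def joined_def)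
    then have "g \<in> C" unfolding C_eq using i(1) by auto
    \<comment> \<open>Equal pairs with \<open>i\<close> different from \<open>m\<close> would make
      each index the cyclic successor of the other, so two steps would return to the start; length
      at least 3 excludes this.\<close>
    have "{vs ! i, vs ! ?next i} \<noteq> {vs ! m, vs ! ?next m}"
    proof
      assume eq: "{vs ! i, vs ! ?next i} = {vs ! m, vs ! ?next m}"
      have next_less: "?next i < ?n" "?next m < ?n" using i(1) by (auto intro: mod_less_divisor)
      with eq i m(1) vs(1) have "i = ?next m" "?next i = m"
        by (auto simp: doubleton_eq_iff nth_eq_iff_index_eq)
      with vs(2) i m(1) show False by (auto simp: mod_Suc split: if_splits)
    qed
    then have "g \<noteq> f" using g(2) m(2) by auto
    with \<open>g \<in> C\<close> f have "g \<notin> F" by auto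
    then have "?x (end1 G g) = ?x (end2 G g)" using sep[OF g(1)] by simp
    then show ?thesis using g(2) by (auto simp: ends_def doubleton_eq_iff)
  qed
  \<comment> \<open>The cyclic shift permutes the indices, which is what makes the sum of
    differences vanish.\<close>
  have "(\<Sum>i<?n. ?x (vs ! ?next i)) = (\<Sum>i<?n. ?x (vs ! i))"
    using vs(2) by (intro sum.reindex_bij_betw bij_betw_Suc_mod) auto
  then have "0 = (\<Sum>i<?n. ?x (vs ! i) - ?x (vs ! ?next i))"
    by (simp add: sum_subtractf)
  also have "\<dots> = (\<Sum>i\<in>{m}. ?x (vs ! i) - ?x (vs ! ?next i))"
    using m(1) flat by (intro sum.mono_neutral_right) auto
  finally have "?x (vs ! m) = ?x (vs ! ?next m)" by simp
  then have "?x (end1 G f) = ?x (end2 G f)"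
    using m(2) by (auto simp: ends_def doubleton_eq_iff)
  then show False using sep[of f] f F by auto
qed

section \<open>The cycle condition puts the ends of each edge of \<open>F\<close> in different
  components\<close>

lemma rtrancl_imp_distinct_path:
  assumes "(x, y) \<in> {(a, b). P a b}\<^sup>*"
  obtains xs where "distinct xs" "xs \<noteq> []" "hd xs = x" "last xs = y" "successively P xs"
proof -
  from assms have "\<exists>xs. distinct xs \<and> xs \<noteq> [] \<and> hd xs = x \<and> last xs = y \<and> successively P xs"
  proof (induction rule: rtrancl_induct)
    case base
    show ?case by (rule exI[of _ "[x]"]) simp
  next
    case (step y z)
    then obtain xs where xs: "distinct xs" "xs \<noteq> []" "hd xs = x" "last xs = y" "successively P xs"
      by blast
    \<comment> \<open>If \<open>z\<close> already lies on the path, cutting the path back to that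
      occurrence keeps its vertices distinct; otherwise \<open>z\<close> is appended.\<close>
    show ?case
    proof (cases "z \<in> set xs")
      case True
      then obtain as bs where "xs = as @ z # bs" by (meson split_list)
      with xs show ?thesis
        by (intro exI[of _ "as @ [z]"]) (auto simp: successively_append_iff hd_append)
    next
      case False
      with xs step.hyps show ?thesis
        by (intro exI[of _ "xs @ [z]"]) (auto simp: successively_append_iff)
    qed
  qed
  with that show thesis by blast
qed

lemma equiv_connected_after_removal: "equiv (vertices G) (connected_after_removal G F)"
proof -
  have "sym ({(i, j). joined G (edges G - F) i j}\<^sup>*)"
    by (intro sym_rtrancl) (auto simp: sym_def joined_sym)
  then show ?thesis
    by (intro equivI)
      (auto simp: connected_after_removal_def refl_on_def sym_def trans_def intro: rtrancl_trans)
qed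

text \<open>A simple path outside \<open>F\<close> between the ends of \<open>f\<close> would be
  closed by \<open>f\<close> to a cycle that meets \<open>F\<close> in \<open>f\<close>
  alone.\<close>

lemma ends_not_connected_after_removal:
  assumes G: "is_flow_graph G" and F: "F \<subseteq> edges G"
    and cycles: "\<And>C. is_cycle G C \<Longrightarrow> C \<inter> F = {} \<or> card (C \<inter> F) \<ge> 2"
    and f: "f \<in> F"
  shows "(end1 G f, end2 G f) \<notin> connected_after_removal G F"
proof
  let ?i = "end1 G f" and ?j = "end2 G f" and ?J = "joined G (edges G - F)"
  assume "(?i, ?j) \<in> connected_after_removal G F"
  then have "(?i, ?j) \<in> {(a, b). ?J a b}\<^sup>*" by (simp add: connected_after_removal_def)
  then obtain vs where vs: "distinct vs" "vs \<noteq> []" "hd vs = ?i" "last vs = ?j" "successively ?J vs"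
    by (rule rtrancl_imp_distinct_path)
  let ?n = "length vs"
  let ?next = "\<lambda>i. Suc i mod ?n"
  have fE: "f \<in> edges G" using f F by auto
  have inj: "inj_on (ends G) (edges G)" and ij: "?i \<noteq> ?j"
    using G fE by (auto simp: is_flow_graph_def)
  have last: "vs ! (?n - 1) = ?j" and first: "vs ! 0 = ?i"
    using vs by (simp_all add: last_conv_nth hd_conv_nth)
  have step: "?J (vs ! i) (vs ! Suc i)" if "Suc i < ?n" for i
    using vs(5) that by (auto simp: successively_conv_nth)
  have not_J: "\<not> ?J ?i ?j"
    using inj f fE by (auto simp: joined_def ends_def inj_on_def)
  \<comment> \<open>Length 1 would make \<open>f\<close> a loop. Length 2 would give an edge outside
    \<open>F\<close> with the same ends as \<open>f\<close>, that is, a parallel edge.\<close>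
  have "?n \<noteq> 0" using vs(2) by simp
  moreover have "?n \<noteq> 1" using first last ij by auto
  moreover have "?n \<noteq> 2"
  proof
    assume n2: "?n = 2"
    with step[of 0] first last not_J show False by simp
  qed
  ultimately have n: "?n \<ge> 3" by linarith
  \<comment> \<open>Each cyclic step is either a step of the path or the closing step from the last
    vertex to the first, which is \<open>f\<close>.\<close>
  have cyc: "Suc i < ?n \<and> ?next i = Suc i \<or> i = ?n - 1 \<and> ?next i = 0" if "i < ?n" for i
    using that by (cases "Suc i = ?n") auto
  have adj: "adjacent G (vs ! i) (vs ! ?next i)" if "i < ?n" for i
    using cyc[OF that]
  proof (elim disjE conjE)
    assume "Suc i < ?n" "?next i = Suc i"
    with step[of i] show ?thesis by (auto simp: adjacent_def intro: joined_mono)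
  next
    assume "i = ?n - 1" "?next i = 0"
    with adjacent_ends[OF fE] show ?thesis
      using first last by (simp add: adjacent_def joined_sym)
  qed
  define C where "C = {g \<in> edges G. \<exists>i<?n. ends G g = {vs ! i, vs ! ?next i}}"
  have "set vs \<subseteq> vertices G"
    using adj adjacent_vertices(1)[OF G] unfolding set_conv_nth by blast
  then have "is_cycle G C"
    unfolding is_cycle_def C_def using vs(1) n adj by blast
  \<comment> \<open>Edges are determined by their ends, so an edge of the cycle at a path step lies
    outside \<open>F\<close>, and the one at the closing step is \<open>f\<close>.\<close>
  moreover have "C \<inter> F = {f}"
  proof (intro equalityI subsetI)
    fix g assume g: "g \<in> C \<inter> F"
    then obtain i where i: "i < ?n" "ends G g = {vs ! i, vs ! ?next i}" and gE: "g \<in> edges G"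
      by (auto simp: C_def)
    from cyc[OF i(1)] show "g \<in> {f}"
    proof (elim disjE conjE)
      assume "Suc i < ?n" "?next i = Suc i"
      with step[of i] i(2) obtain h where "h \<in> edges G - F" "ends G h = ends G g"
        by (auto simp: joined_def)
      with inj gE g show ?thesis by (auto simp: inj_on_def)
    next
      assume "i = ?n - 1" "?next i = 0"
      then have "ends G g = {?i, ?j}" using i(2) first last by auto
      then have "ends G g = ends G f" by (simp add: ends_def)
      with inj gE fE show ?thesis by (auto simp: inj_on_def)
    qed
  next
    fix g assume "g \<in> {f}"
    moreover have "ends G f = {vs ! (?n - 1), vs ! ?next (?n - 1)}"
      using first last vs(2) by (simp add: ends_def insert_commute)
    moreover have "?n - 1 < ?n" using vs(2) by simp
    ultimately show "g \<in> C \<inter> F" using f fE unfolding C_def by blast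
  qed
  ultimately show False using cycles[of C] by simp
qed

section \<open>Avoiding finitely many hyperplanes by a small perturbation\<close>

lemma perturb_off_hyperplanes:
  fixes L :: "'i \<Rightarrow> ('a \<Rightarrow> real) \<Rightarrow> real"
  assumes "finite I"
    and lin: "\<And>i x y d. i \<in> I \<Longrightarrow> L i (\<lambda>a. x a + d * y a) = L i x + d * L i y"
    and dir: "\<And>i. i \<in> I \<Longrightarrow> \<exists>y. (\<forall>a. \<bar>y a\<bar> \<le> 1) \<and> L i y \<noteq> 0"
    and "0 < (e::real)"
  shows "\<exists>x'. (\<forall>a. \<bar>x' a - x a\<bar> \<le> e) \<and> (\<forall>i\<in>I. L i x' \<noteq> 0)"
  using assms
proof (induction I arbitrary: e rule: finite_induct)
  case empty
  then show ?case by (intro exI[of _ x]) auto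
next
  case (insert j I)
  \<comment> \<open>Half of the allowance \<open>e\<close> goes into avoiding the earlier
    hyperplanes; the other half remains for moving off that of \<open>j\<close>.\<close>
  have "\<exists>x'. (\<forall>a. \<bar>x' a - x a\<bar> \<le> e / 2) \<and> (\<forall>i\<in>I. L i x' \<noteq> 0)"
    by (rule insert.IH) (use insert.prems in auto)
  then obtain z where z: "\<And>a. \<bar>z a - x a\<bar> \<le> e / 2" "\<And>i. i \<in> I \<Longrightarrow> L i z \<noteq> 0" by blast
  obtain y where y: "\<And>a. \<bar>y a\<bar> \<le> 1" "L j y \<noteq> 0" using insert.prems(2)[of j] by auto
  \<comment> \<open>Along the line \<open>z + d * y\<close> each functional vanishes for at most one \<open>d\<close>.\<close>
  let ?bad = "(\<lambda>i. - L i z / L i y) ` insert j I"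
  have "infinite {0<..<e / 2}" using \<open>0 < e\<close> by (simp add: infinite_Ioo)
  then have "\<not> {0<..<e / 2} \<subseteq> ?bad" using insert.hyps(1) by (meson finite.insertI finite_imageI finite_subset)
  then obtain d where "d \<in> {0<..<e / 2}" and bad: "d \<notin> ?bad" by blast
  then have d: "0 < d" "d < e / 2" by simp_all
  show ?case
  proof (intro exI[of _ "\<lambda>a. z a + d * y a"] conjI allI ballI)
    fix a
    have "\<bar>d * y a\<bar> \<le> d * 1" unfolding abs_mult using d(1) y(1)[of a] by (intro mult_mono) auto
    then show "\<bar>z a + d * y a - x a\<bar> \<le> e" using z(1)[of a] d(2) by linarith
  next
    fix i assume i: "i \<in> insert j I"
    \<comment> \<open>If \<open>L i y = 0\<close>, then \<open>i\<close> is not \<open>j\<close>,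
      and the functional keeps along the line the nonzero value it has at \<open>z\<close>.
      Otherwise its only zero is among the excluded values of \<open>d\<close>.\<close>
    have "L i z + d * L i y \<noteq> 0"
    proof (cases "L i y = 0")
      case True
      with i y(2) z(2) show ?thesis by auto
    next
      case False
      have "d \<noteq> - L i z / L i y" using bad i by blast
      with False show ?thesis by (auto simp: field_simps)
    qed
    with insert.prems(1)[OF i] show "L i (\<lambda>a. z a + d * y a) \<noteq> 0" by simp
  qed
qed

section \<open>Stealth vectors from a numbering of the components\<close>

lemma divergence_linear:
  "divergence G (\<lambda>v. x v + d * y v) v = divergence G x v + d * divergence G y v"
  by (simp add: divergence_def algebra_simps sum.distrib sum_distrib_left sum_subtractf)

text \<open>Distinct component numbers below \<open>k\<close> differ by at least 1 and at most
  \<open>k - 1\<close>. Moving every value by at most \<open>e / 2\<close> changes a difference by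
  at most \<open>e\<close>, and \<open>e < 1\<close> keeps the differences on \<open>F\<close>
  positive.\<close>

lemma stealth_vector_near_numbering:
  assumes G: "is_flow_graph G" and F: "F \<subseteq> edges G"
    and sep: "\<And>f. f \<in> F \<Longrightarrow> (end1 G f, end2 G f) \<notin> connected_after_removal G F"
    and e: "0 < e" "e < 1"
  shows "\<exists>s. stealth_vector G F s \<and>
    (\<forall>f\<in>F. 1 - e \<le> edge_difference G s f \<and>
           edge_difference G s f \<le> real (num_components_after_removal G F) - 1 + e)"
proof -
  let ?V = "vertices G" and ?R = "connected_after_removal G F"
  let ?k = "num_components_after_removal G F"
  let ?c = "\<lambda>v. ?R `` {v}"
  note eq = equiv_connected_after_removal[of G F]
  have same: "?c u = ?c v \<longleftrightarrow> (u, v) \<in> ?R" if "u \<in> ?V" "v \<in> ?V" for u v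
    using eq_equiv_class_iff[OF eq that] .
  have joined_same: "?c u = ?c v" if "joined G (edges G - F) u v" for u v
  proof -
    have "adjacent G u v" using joined_mono[OF that] by (simp add: adjacent_def)
    note uv = adjacent_vertices[OF G this]
    show ?thesis unfolding same[OF uv] using that uv by (auto simp: connected_after_removal_def)
  qed
  have "finite (?V // ?R)"
    by (rule finite_quotient[OF finite_vertices equiv_type[OF eq]])
  then obtain num where num: "bij_betw num (?V // ?R) {0..<?k}"
    unfolding num_components_after_removal_def using ex_bij_betw_finite_nat by blast
  let ?W = "{v \<in> ?V. \<exists>f\<in>F. v \<in> ends G f}"
  \<comment> \<open>The perturbed values are attached to components, not to vertices, so the result
    stays constant on each component.\<close>
  let ?L = "\<lambda>v x. divergence G (\<lambda>u. x (?c u)) v"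
  \<comment> \<open>For the indicator of the component of \<open>v\<close>, the divergence at
    \<open>v\<close> is the total gain towards neighbours in other components. The other end of an
    edge of \<open>F\<close> at \<open>v\<close> is such a neighbour, so the sum is
    positive.\<close>
  have W: "?L v (\<lambda>K. if K = ?c v then 1 else 0) \<noteq> 0" if vW: "v \<in> ?W" for v
  proof -
    let ?N = "{u. u \<in> ?V \<and> adjacent G v u}"
    let ?g = "\<lambda>u. gain G v u * (1 - (if ?c u = ?c v then 1 else 0))"
    obtain f where f: "f \<in> F" "v \<in> ends G f" and v: "v \<in> ?V" using vW by blast
    have fE: "f \<in> edges G" using f F by auto
    note fV = end_in_vertices[OF G fE]
    have diff: "?c (end1 G f) \<noteq> ?c (end2 G f)" using sep[OF f(1)] same[OF fV] by simp
    obtain w where w: "w \<in> ?N" "?c w \<noteq> ?c v"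
    proof (cases "v = end1 G f")
      case True
      with that[of "end2 G f"] fV diff adjacent_ends[OF fE] show thesis by auto
    next
      case False
      then have "v = end2 G f" using f(2) by (auto simp: ends_def)
      with that[of "end1 G f"] fV diff adjacent_ends[OF fE] show thesis
        by (auto simp: adjacent_def joined_sym)
    qed
    have pos: "gain G v u > 0" if "u \<in> ?N" for u
      using that G unfolding is_flow_graph_def by blast
    have "0 < sum ?g ?N"
    proof (rule sum_pos2[OF _ w(1)])
      show "0 < ?g w" using pos[OF w(1)] w(2) by simp
      show "0 \<le> ?g u" if "u \<in> ?N" for u using pos[OF that] by simp
    qed simp
    then show ?thesis by (simp add: divergence_def)
  qed
  have "\<exists>p. (\<forall>K. \<bar>p K - real (num K)\<bar> \<le> e / 2) \<and> (\<forall>v\<in>?W. ?L v p \<noteq> 0)"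
  proof (rule perturb_off_hyperplanes)
    fix v assume "v \<in> ?W"
    with W show "\<exists>y. (\<forall>K. \<bar>y K\<bar> \<le> 1) \<and> ?L v y \<noteq> 0"
      by (intro exI[of _ "\<lambda>K. if K = ?c v then 1 else 0"]) auto
  qed (use e in \<open>auto simp: divergence_linear\<close>)
  then obtain p where p: "\<And>K. \<bar>p K - real (num K)\<bar> \<le> e / 2" "\<And>v. v \<in> ?W \<Longrightarrow> ?L v p \<noteq> 0"
    by blast
  define s where "s = vec (num_verts G) (\<lambda>i. p (?c (i + 1)))"
  have s: "s \<in> carrier_vec (num_verts G)" by (simp add: s_def)
  have entry_s: "entry s v = p (?c v)" if "v \<in> ?V" for v
    using that by (auto simp: entry_def s_def vertices_def)
  have div_s: "divergence G (entry s) v = ?L v p" if "v \<in> ?V" for v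
    unfolding divergence_def using that by (intro sum.cong) (auto simp: entry_s)
  have range: "1 - e \<le> edge_difference G s f \<and> edge_difference G s f \<le> real ?k - 1 + e"
    if f: "f \<in> F" for f
  proof -
    have fE: "f \<in> edges G" using f F by auto
    note fV = end_in_vertices[OF G fE]
    let ?A = "?c (end1 G f)" and ?B = "?c (end2 G f)"
    have AB: "?A \<in> ?V // ?R" "?B \<in> ?V // ?R" using fV by (auto intro: quotientI)
    have "?A \<noteq> ?B" using sep[OF f] same[OF fV] by simp
    then have ne: "num ?A \<noteq> num ?B" using num AB by (auto simp: bij_betw_def inj_on_def)
    have less: "num ?A < ?k" "num ?B < ?k" using num AB by (auto dest: bij_betwE)
    have "1 \<le> \<bar>real (num ?A) - real (num ?B)\<bar>" "\<bar>real (num ?A) - real (num ?B)\<bar> \<le> real ?k - 1"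
      using ne less by linarith+
    moreover have "edge_difference G s f = \<bar>p ?A - p ?B\<bar>"
      using fV by (simp add: edge_difference_def entry_s)
    ultimately show ?thesis using p(1)[of ?A] p(1)[of ?B] by linarith
  qed
  have "stealth_vector G F s"
    unfolding stealth_vector_iff[OF G F s]
  proof (intro conjI ballI iffI)
    fix f assume "f \<in> edges G" and ne: "entry s (end1 G f) \<noteq> entry s (end2 G f)"
    note fV = end_in_vertices[OF G this(1)]
    show "f \<in> F"
    proof (rule ccontr)
      assume "f \<notin> F"
      then have "?c (end1 G f) = ?c (end2 G f)"
        using \<open>f \<in> edges G\<close> by (intro joined_same joined_ends) auto
      with ne fV show False by (simp add: entry_s)
    qed
  next
    fix f assume "f \<in> F"
    then have "0 < edge_difference G s f" using range[of f] e by auto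
    then show "entry s (end1 G f) \<noteq> entry s (end2 G f)" by (auto simp: edge_difference_def)
  next
    fix v assume v: "v \<in> ?V" and ne: "divergence G (entry s) v \<noteq> 0"
    show "\<exists>f\<in>F. v \<in> ends G f"
    proof (rule ccontr)
      assume none: "\<not> (\<exists>f\<in>F. v \<in> ends G f)"
      \<comment> \<open>No edge at \<open>v\<close> is in \<open>F\<close>, so every neighbour
        shares its component and each term of the divergence is 0.\<close>
      have "?c v = ?c u" if "adjacent G v u" for u
        using that none by (intro joined_same) (auto simp: adjacent_def joined_def)
      then have "?L v p = 0" by (auto simp: divergence_def intro!: sum.neutral)
      with ne div_s[OF v] show False by simp
    qed
  next
    fix v assume "v \<in> ?V" "\<exists>f\<in>F. v \<in> ends G f"
    with p(2)[of v] div_s[of v] show "divergence G (entry s) v \<noteq> 0" by simp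
  qed
  with range show ?thesis by blast
qed

section \<open>Bounds on the edge variation factor\<close>

lemma Max_Min_edge_difference:
  assumes G: "is_flow_graph G" and F: "F \<subseteq> edges G" "F \<noteq> {}" and s: "stealth_vector G F s"
  shows "1 \<le> Max (edge_difference G s ` F) / Min (edge_difference G s ` F)"
proof -
  let ?D = "edge_difference G s ` F"
  have D: "finite ?D" "?D \<noteq> {}" using F finite_subset[OF F(1) finite_edges] by auto
  have carrier: "s \<in> carrier_vec (num_verts G)" using s by (simp add: stealth_vector_def)
  have "Min ?D \<in> ?D" using D by (rule Min_in)
  \<comment> \<open>The minimum is attained at an edge of \<open>F\<close>, whose ends
    \<open>s\<close> separates, so the quotient has a positive denominator.\<close>
  then have "0 < Min ?D"
    using s[unfolded stealth_vector_iff[OF G F(1) carrier]] F(1) by (auto simp: edge_difference_def)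
  moreover have "Min ?D \<le> Max ?D" using D Min_in Max_ge by blast
  ultimately show ?thesis by simp
qed

text \<open>The stealth vectors near the numbering bound the infimum by
  \<open>(k - 1 + e) / (1 - e)\<close> for every \<open>e\<close> between 0 and 1; letting
  \<open>e\<close> tend to 0 from the right gives \<open>k - 1\<close>.\<close>

lemma edge_variation_factor_le:
  assumes G: "is_flow_graph G" and F: "F \<subseteq> edges G" "F \<noteq> {}"
    and sep: "\<And>f. f \<in> F \<Longrightarrow> (end1 G f, end2 G f) \<notin> connected_after_removal G F"
  shows "edge_variation_factor G F \<le> real (num_components_after_removal G F) - 1"
proof -
  let ?k = "real (num_components_after_removal G F)"
  let ?ratio = "\<lambda>s. Max (edge_difference G s ` F) / Min (edge_difference G s ` F)"
  let ?\<theta> = "edge_variation_factor G F"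
  have bdd: "bdd_below {?ratio s | s. stealth_vector G F s}"
    using Max_Min_edge_difference[OF G F] by (auto intro!: bdd_belowI[of _ 1])
  have bound: "?\<theta> \<le> (?k - 1 + e) / (1 - e)" if e: "0 < e" "e < 1" for e
  proof -
    obtain s where s: "stealth_vector G F s"
      and D: "\<And>f. f \<in> F \<Longrightarrow> 1 - e \<le> edge_difference G s f"
        "\<And>f. f \<in> F \<Longrightarrow> edge_difference G s f \<le> ?k - 1 + e"
      using stealth_vector_near_numbering[OF G F(1) sep e] by blast
    let ?D = "edge_difference G s ` F"
    have fin: "finite ?D" "?D \<noteq> {}" using F finite_subset[OF F(1) finite_edges] by auto
    have "?\<theta> \<le> ?ratio s"
      unfolding edge_variation_factor_def using s by (intro cInf_lower[OF _ bdd]) blast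
    also have "\<dots> \<le> (?k - 1 + e) / (1 - e)"
    proof (rule frac_le)
      show "Max ?D \<le> ?k - 1 + e" "1 - e \<le> Min ?D" using fin D by auto
      \<comment> \<open>Monotonicity of the fraction requires a nonnegative upper numerator; any
        edge of \<open>F\<close> gives it, as its positive difference lies below that
        numerator.\<close>
      obtain f where "f \<in> F" using F by auto
      with D[of f] e show "0 \<le> ?k - 1 + e" by linarith
    qed (use e in simp)
    finally show ?thesis .
  qed
  have "((\<lambda>e. (?k - 1 + e) / (1 - e)) \<longlongrightarrow> (?k - 1 + 0) / (1 - 0)) (at_right 0)"
    by (intro tendsto_intros) auto
  moreover have "\<forall>\<^sub>F e in at_right (0::real). ?\<theta> \<le> (?k - 1 + e) / (1 - e)"
    unfolding eventually_at_right_field using bound by (intro exI[of _ 1]) auto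
  ultimately have "?\<theta> \<le> (?k - 1 + 0) / (1 - 0)"
    by (rule tendsto_lowerbound) simp
  then show ?thesis by simp
qed

text \<open>The bounds are claimed for nonempty \<open>F\<close> only: with \<open>F\<close> empty
  and \<open>G\<close> connected, \<open>k - 1\<close> is 0, so no number could satisfy
  both.\<close>

theorem theorem2:
  fixes G :: flow_graph and F :: "nat set"
  assumes "is_flow_graph G" and "F \<subseteq> edges G"
  shows "(stealthily_attackable G F \<longleftrightarrow>
            (\<forall>C. is_cycle G C \<longrightarrow> C \<inter> F = {} \<or> card (C \<inter> F) \<ge> 2)) \<and>
         (stealthily_attackable G F \<and> F \<noteq> {} \<longrightarrow>
            1 \<le> edge_variation_factor G F \<and>
            edge_variation_factor G F \<le> real (num_components_after_removal G F) - 1)"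
proof -
  let ?cycles = "\<forall>C. is_cycle G C \<longrightarrow> C \<inter> F = {} \<or> card (C \<inter> F) \<ge> 2"
  have cycles: ?cycles if "stealthily_attackable G F"
    using that stealth_vector_cycle[OF assms] unfolding stealthily_attackable_iff by blast
  have sep: "(end1 G f, end2 G f) \<notin> connected_after_removal G F" if ?cycles "f \<in> F" for f
    using ends_not_connected_after_removal[OF assms _ that(2)] that(1) by blast
  \<comment> \<open>Only existence matters here, so any \<open>e\<close> strictly between 0 and 1
    serves.\<close>
  have attack: "stealthily_attackable G F" if ?cycles
    using stealth_vector_near_numbering[OF assms sep[OF that], of "1 / 2"]
    unfolding stealthily_attackable_iff by auto
  \<comment> \<open>Attackability makes the set of ratios nonempty, so its lower bound 1 passes to
    the real infimum.\<close>
  have "1 \<le> edge_variation_factor G F" if "stealthily_attackable G F" "F \<noteq> {}"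
    unfolding edge_variation_factor_def
    using that(1) Max_Min_edge_difference[OF assms that(2)]
    by (intro cInf_greatest) (auto simp: stealthily_attackable_iff)
  moreover have "edge_variation_factor G F \<le> real (num_components_after_removal G F) - 1"
    if "stealthily_attackable G F" "F \<noteq> {}"
    using edge_variation_factor_le[OF assms that(2) sep[OF cycles[OF that(1)]]] .
  ultimately show ?thesis using cycles attack by blast
qed

end
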